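(* Let $X$ be a $T_0$ core compact topological space, let $S$ be a subbasis of $X$, and let $\vdash$ be the relation on $\mathsf{F}S$ given by $F\vdash G\Leftrightarrow\bigcap F\Subset\bigcup G$. Then \[x\mapsto S_x=\{p\in S:x\in p\}\] is a homeomorphism from $X$ onto a very dense subspace of the tight spectrum $\mathsf{T}^S$ of $(S,\vdash)$. Moreover: (1) if $X$ is core coherent, then $(S_x)_{x\in X}$ is even strongly dense in $\mathsf{T}^S$; (2) if $X$ is also sober (i.e. $X$ is core coherent and sober), then $(S_x)_{x\in X}$ is the whole of $\mathsf{T}^S$.
   Context: $\mathsf{F}S$ is the set of finite subsets of $S$ (including $\emptyset$). A subbasis $S$ of $X$ is a family of open sets covering $X$ and generating its topology; $\bigcap\emptyset=X$ and $\bigcup\emptyset=\emptyset$. For $p,q\subseteq X$, $p\Subset q$ means every cover of $q$ by open sets of $X$ has a finite subfamily covering $p$. $X$ is core compact if whenever $x\in p$ with $p$ open there is an open $q$ with $x\in q\Subset p$; core coherent if for open $p,q,r$, $p\Subset q$ and $p\Subset r$ imply $p\Subset q\cap r$; sober if every irreducible closed set is the closure of a unique point. $T\subseteq S$ is tight if for all $G\in\mathsf{F}S$: ($F\vdash G$ for some finite $F\subseteq T$) iff $T\cap G\neq\emptyset$. The tight spectrum $\mathsf{T}^S$ is the set of all non-empty tight subsets of $S$, with the topology generated by the sets $\mathsf{T}_p=\{T\in\mathsf{T}^S:p\in T\}$, $p\in S$. In a topological space $Z$: $x\to y$ (specialisation) means every open set containing $y$ contains $x$; the saturation of $Y\subseteq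 Z$ is $\mathrm{sat}(Y)=\{x:\exists y\in Y\ (x\to y)\}$, the intersection of all open sets containing $Y$; $Y$ is saturated if $Y=\mathrm{sat}(Y)$. The patch topology on $Z$ is generated by the open sets and the complements of compact saturated sets; its closure operator is $\mathrm{cl}_\square$. $D\subseteq Z$ is very dense if $\mathrm{sat}(D)=Z=\mathrm{cl}_\square(D)$. The strong patch topology on $Z$ is generated by all open sets and all closed sets of $Z$; $D$ is strongly dense if it is dense in the strong patch topology. *)

theory Defs
  imports "HOL-Analysis.Analysis"
begin

section \<open>Spaces and their way-below relation\<close>

definition subbasis_of :: "'a topology \<Rightarrow> 'a set set \<Rightarrow> bool" where
  "subbasis_of X S \<longleftrightarrow>
     (\<forall>p\<in>S. openin X p) \<and> \<Union>S = topspace X \<and> topology_generated_by S = X"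

definition way_below :: "'a topology \<Rightarrow> 'a set \<Rightarrow> 'a set \<Rightarrow> bool" where
  "way_below X p q \<longleftrightarrow>
     (\<forall>\<C>. (\<forall>U\<in>\<C>. openin X U) \<and> q \<subseteq> \<Union>\<C> \<longrightarrow> (\<exists>\<F>. finite \<F> \<and> \<F> \<subseteq> \<C> \<and> p \<subseteq> \<Union>\<F>))"

definition core_compact :: "'a topology \<Rightarrow> bool" where
  "core_compact X \<longleftrightarrow>
     (\<forall>p x. openin X p \<and> x \<in> p \<longrightarrow> (\<exists>q. openin X q \<and> x \<in> q \<and> way_below X q p))"

definition core_coherent :: "'a topology \<Rightarrow> bool" where
  "core_coherent X \<longleftrightarrow>
     (\<forall>p q r. openin X p \<and> openin X q \<and> openin X r \<and> way_below X p q \<and> way_below X p r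
        \<longrightarrow> way_below X p (q \<inter> r))"

text \<open>As usual, irreducible sets are required to be non-empty.\<close>

definition irreducible_closed :: "'a topology \<Rightarrow> 'a set \<Rightarrow> bool" where
  "irreducible_closed X C \<longleftrightarrow> closedin X C \<and> C \<noteq> {} \<and>
     (\<forall>A B. closedin X A \<and> closedin X B \<and> C = A \<union> B \<longrightarrow> C = A \<or> C = B)"

definition sober :: "'a topology \<Rightarrow> bool" where
  "sober X \<longleftrightarrow>
     (\<forall>C. irreducible_closed X C \<longrightarrow> (\<exists>!x. x \<in> topspace X \<and> C = X closure_of {x}))"

section \<open>Tight spectra\<close>

text \<open>A relation on the finite subsets of \<open>S\<close> is represented by a predicate on arbitrary sets, of
  which only the values on finite subsets of \<open>S\<close> are used.\<close>

definition tight :: "'b set \<Rightarrow> ('b set \<Rightarrow> 'b set \<Rightarrow> bool) \<Rightarrow> 'b set \<Rightarrow> bool" where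
  "tight S ent T \<longleftrightarrow> T \<subseteq> S \<and>
     (\<forall>G. finite G \<and> G \<subseteq> S \<longrightarrow>
        ((\<exists>F. finite F \<and> F \<subseteq> T \<and> ent F G) \<longleftrightarrow> T \<inter> G \<noteq> {}))"

definition tight_points :: "'b set \<Rightarrow> ('b set \<Rightarrow> 'b set \<Rightarrow> bool) \<Rightarrow> 'b set set" where
  "tight_points S ent = {T. tight S ent T \<and> T \<noteq> {}}"

definition tight_spectrum :: "'b set \<Rightarrow> ('b set \<Rightarrow> 'b set \<Rightarrow> bool) \<Rightarrow> 'b set topology" where
  "tight_spectrum S ent =
     topology_generated_by ((\<lambda>p. {T \<in> tight_points S ent. p \<in> T}) ` S)"

lemma topspace_tight_spectrum: "topspace (tight_spectrum S ent) = tight_points S ent"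
  unfolding tight_spectrum_def topology_generated_by_topspace
  by (auto simp: tight_points_def tight_def)

text \<open>Intersecting with \<open>topspace X\<close> makes the empty intersection the whole space.\<close>

definition cover_entails :: "'a topology \<Rightarrow> 'a set set \<Rightarrow> 'a set set \<Rightarrow> bool" where
  "cover_entails X F G \<longleftrightarrow> way_below X (topspace X \<inter> \<Inter>F) (\<Union>G)"

definition subbasic_nbhds :: "'a set set \<Rightarrow> 'a \<Rightarrow> 'a set set" where
  "subbasic_nbhds S x = {p \<in> S. x \<in> p}"

section \<open>Saturation, patch topologies and density\<close>

text \<open>\<open>specialises Z x y\<close> reads \<open>x \<rightarrow> y\<close>: the point \<open>y\<close> lies in the closure of \<open>x\<close>.\<close>

definition specialises :: "'a topology \<Rightarrow> 'a \<Rightarrow> 'a \<Rightarrow> bool" where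
  "specialises Z x y \<longleftrightarrow> (\<forall>U. openin Z U \<and> y \<in> U \<longrightarrow> x \<in> U)"

definition saturation :: "'a topology \<Rightarrow> 'a set \<Rightarrow> 'a set" where
  "saturation Z Y = {x \<in> topspace Z. \<exists>y\<in>Y. specialises Z x y}"

definition saturated :: "'a topology \<Rightarrow> 'a set \<Rightarrow> bool" where
  "saturated Z Y \<longleftrightarrow> Y = saturation Z Y"

definition patch_topology :: "'a topology \<Rightarrow> 'a topology" where
  "patch_topology Z = topology_generated_by
     ({U. openin Z U} \<union> {topspace Z - K | K. compactin Z K \<and> saturated Z K})"

definition strong_patch_topology :: "'a topology \<Rightarrow> 'a topology" where
  "strong_patch_topology Z = topology_generated_by ({U. openin Z U} \<union> {C. closedin Z C})"

definition very_dense :: "'a topology \<Rightarrow> 'a set \<Rightarrow> bool" where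
  "very_dense Z D \<longleftrightarrow> D \<subseteq> topspace Z \<and>
     saturation Z D = topspace Z \<and> patch_topology Z closure_of D = topspace Z"

definition strongly_dense :: "'a topology \<Rightarrow> 'a set \<Rightarrow> bool" where
  "strongly_dense Z D \<longleftrightarrow> D \<subseteq> topspace Z \<and>
     strong_patch_topology Z closure_of D = topspace Z"

end

theory Submission
  imports Defs
begin

text \<open>
  Write \<open>S\<^sub>x\<close> for \<open>subbasic_nbhds S x\<close>. A tight set \<open>T\<close> behaves like the set of subbasic
  neighbourhoods of an ideal point, and everything follows from a way to approximate it by true
  points: if \<open>F\<close> is a finite subset of \<open>T\<close> and \<open>\<Inter>F \<Subset> U\<close>, then \<open>U\<close> contains a point \<open>x\<close> with
  \<open>S\<^sub>x \<subseteq> T\<close> (lemma \<open>point_of_tight_set_in\<close>). Otherwise \<open>U\<close> would be covered by the members of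
  \<open>S - T\<close>. In a core compact space the cover can be shrunk before a finite subcover of \<open>\<Inter>F\<close> is
  taken, so that \<open>\<Inter>F \<Subset> \<Union>G\<close> for some finite \<open>G \<subseteq> S - T\<close>, not merely \<open>\<Inter>F \<subseteq> \<Union>G\<close>
  (lemma \<open>way_below_subcover\<close>). This is \<open>F \<turnstile> G\<close>, which tightness of \<open>T\<close> forbids.

  In the spectrum, \<open>T \<rightarrow> T'\<close> means \<open>T' \<subseteq> T\<close>. A member \<open>p\<close> of a tight set \<open>T\<close> satisfies
  \<open>F \<turnstile> {p}\<close> for some finite \<open>F \<subseteq> T\<close>, so there is an \<open>x\<close> with \<open>S\<^sub>x \<subseteq> T\<close>, which is the
  saturation half of very density. For the patch half, let \<open>T\<close> lie in a basic open set given by a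
  finite \<open>F \<subseteq> T\<close> and outside a compact saturated \<open>K\<close>. Each \<open>k \<in> K\<close> has a member \<open>p\<^sub>k \<notin> T\<close> and
  a finite subset \<open>H\<^sub>k \<turnstile> {p\<^sub>k}\<close>. Finitely many of the sets of tight points containing some \<open>H\<^sub>k\<close>
  cover \<open>K\<close>. If all \<open>S\<^sub>x\<close> with \<open>x \<in> \<Inter>F\<close> were in \<open>K\<close>, then \<open>\<Inter>F\<close> would lie in the union of
  the corresponding \<open>\<Inter>H\<^sub>k\<close>, hence be way below the union of the \<open>p\<^sub>k\<close>, again contradicting
  tightness. The detour through the \<open>H\<^sub>k\<close> is what turns an inclusion into a way-below
  relation.

  With core coherence, \<open>\<Inter>F\<close> itself is way above \<open>\<Inter>F'\<close> for some finite \<open>F' \<subseteq> T\<close>, so the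
  approximating point can be chosen with \<open>F \<subseteq> S\<^sub>x \<subseteq> T\<close>
  (lemma \<open>coherent_point_of_tight_set\<close>). The second inclusion puts \<open>S\<^sub>x\<close> in every closed set
  containing \<open>T\<close>, which gives strong density. It also makes \<open>{x. S\<^sub>x \<subseteq> T}\<close> an irreducible closed
  set; when \<open>X\<close> is sober, its generic point \<open>x\<close> satisfies \<open>S\<^sub>x = T\<close>.
\<close>

section \<open>Neighbourhoods in generated topologies\<close>

text \<open>To find small neighbourhoods of \<open>t\<close> of a given shape, it suffices that the shape is stable under
  binary intersections and occurs inside every generator around \<open>t\<close>: the union step of the
  generation only enlarges a set. The patch topologies, \<open>X\<close> and the spectrum are all treated this
  way.\<close>

lemma generated_topology_nbhd:
  assumes "openin (topology_generated_by \<B>) W" "t \<in> W"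
    and Int: "\<And>M N. M \<in> \<N> \<Longrightarrow> N \<in> \<N> \<Longrightarrow> M \<inter> N \<in> \<N>"
    and basis: "\<And>B. B \<in> \<B> \<Longrightarrow> t \<in> B \<Longrightarrow> \<exists>N\<in>\<N>. t \<in> N \<and> N \<subseteq> B"
  shows "\<exists>N\<in>\<N>. t \<in> N \<and> N \<subseteq> W"
proof -
  have "generate_topology_on \<B> W"
    using assms(1) by (simp add: openin_topology_generated_by_iff)
  then show ?thesis
    using \<open>t \<in> W\<close>
  proof (induction rule: generate_topology_on.induct)
    case (Int a b)
    then obtain M N where "M \<in> \<N>" "t \<in> M" "M \<subseteq> a" "N \<in> \<N>" "t \<in> N" "N \<subseteq> b"
      by blast
    then show ?case
      using assms(3)[of M N] by blast
  next
    case (UN K)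
    then obtain k where "k \<in> K" "t \<in> k"
      by blast
    then obtain N where "N \<in> \<N>" "t \<in> N" "N \<subseteq> k"
      using UN.IH by blast
    then show ?case
      using \<open>k \<in> K\<close> by blast
  qed (use basis in simp_all)
qed

lemma subbasis_nbhd:
  assumes "subbasis_of X S" "openin X U" "x \<in> U"
  obtains F where "finite F" "F \<subseteq> subbasic_nbhds S x" "topspace X \<inter> \<Inter>F \<subseteq> U"
proof -
  let ?\<N> = "{topspace X \<inter> \<Inter>F | F. finite F \<and> F \<subseteq> S}"
  have gen: "topology_generated_by S = X"
    using assms(1) by (simp add: subbasis_of_def)
  have "\<exists>N\<in>?\<N>. x \<in> N \<and> N \<subseteq> U"
  proof (rule generated_topology_nbhd[where \<B> = S])
    show "openin (topology_generated_by S) U"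
      using assms(2) gen by simp
    show "x \<in> U"
      by fact
  next
    fix M N
    assume "M \<in> ?\<N>" "N \<in> ?\<N>"
    then obtain F G where FG: "finite F" "F \<subseteq> S" "M = topspace X \<inter> \<Inter>F"
      "finite G" "G \<subseteq> S" "N = topspace X \<inter> \<Inter>G"
      by blast
    then have "M \<inter> N = topspace X \<inter> \<Inter>(F \<union> G)"
      by blast
    then show "M \<inter> N \<in> ?\<N>"
      using FG by (intro CollectI exI[of _ "F \<union> G"]) auto
  next
    fix p
    assume p: "p \<in> S" "x \<in> p"
    have "x \<in> topspace X"
      using assms(2,3) openin_subset by blast
    show "\<exists>N\<in>?\<N>. x \<in> N \<and> N \<subseteq> p"
    proof (intro bexI conjI)
      show "topspace X \<inter> \<Inter>{p} \<in> ?\<N>"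
        using p by (intro CollectI exI[of _ "{p}"]) auto
    qed (use p \<open>x \<in> topspace X\<close> in auto)
  qed
  then obtain F where "finite F" "F \<subseteq> S" "x \<in> topspace X \<inter> \<Inter>F" "topspace X \<inter> \<Inter>F \<subseteq> U"
    by blast
  then show thesis
    by (intro that[of F]) (auto simp: subbasic_nbhds_def)
qed

text \<open>A single \<open>K\<close> suffices because compact saturated sets are closed under finite unions.\<close>

lemma openin_patch_nbhd:
  assumes "openin (patch_topology Z) W" "t \<in> W"
  obtains U K where "openin Z U" "compactin Z K" "saturated Z K" "t \<in> U" "t \<notin> K" "U - K \<subseteq> W"
proof -
  let ?\<N> = "{U - K | U K. openin Z U \<and> compactin Z K \<and> saturated Z K}"
  have empty: "compactin Z {}" "saturated Z {}"
    by (auto simp: saturated_def saturation_def)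
  have "\<exists>N\<in>?\<N>. t \<in> N \<and> N \<subseteq> W"
  proof (rule generated_topology_nbhd[OF assms[unfolded patch_topology_def]])
    fix M N
    assume "M \<in> ?\<N>" "N \<in> ?\<N>"
    then obtain U K V L where *: "M = U - K" "openin Z U" "compactin Z K" "saturated Z K"
      "N = V - L" "openin Z V" "compactin Z L" "saturated Z L"
      by blast
    then have "saturated Z (K \<union> L)"
      unfolding saturated_def saturation_def by blast
    moreover have "M \<inter> N = (U \<inter> V) - (K \<union> L)"
      using * by blast
    ultimately show "M \<inter> N \<in> ?\<N>"
      using * compactin_Un[of Z K L] openin_Int[of Z U V] by blast
  next
    fix B
    assume "B \<in> {U. openin Z U} \<union> {topspace Z - K | K. compactin Z K \<and> saturated Z K}" "t \<in> B"
    then have "B \<in> ?\<N>"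
    proof (elim UnE)
      assume "B \<in> {U. openin Z U}"
      then show ?thesis
        using empty by (intro CollectI exI[of _ B] exI[of _ "{}"]) auto
    qed blast
    then show "\<exists>N\<in>?\<N>. t \<in> N \<and> N \<subseteq> B"
      by (rule bexI[rotated]) (simp add: \<open>t \<in> B\<close>)
  qed
  then show thesis
    using that by blast
qed

lemma openin_strong_patch_nbhd:
  assumes "openin (strong_patch_topology Z) W" "t \<in> W"
  obtains U C where "openin Z U" "closedin Z C" "t \<in> U" "t \<in> C" "U \<inter> C \<subseteq> W"
proof -
  let ?\<N> = "{U \<inter> C | U C. openin Z U \<and> closedin Z C}"
  have "\<exists>N\<in>?\<N>. t \<in> N \<and> N \<subseteq> W"
  proof (rule generated_topology_nbhd[OF assms[unfolded strong_patch_topology_def]])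
    fix M N
    assume "M \<in> ?\<N>" "N \<in> ?\<N>"
    then obtain U C V E where *: "M = U \<inter> C" "openin Z U" "closedin Z C"
      "N = V \<inter> E" "openin Z V" "closedin Z E"
      by blast
    then have "M \<inter> N = (U \<inter> V) \<inter> (C \<inter> E)"
      by blast
    then show "M \<inter> N \<in> ?\<N>"
      using * closedin_Int[of Z C E] openin_Int[of Z U V] by blast
  next
    fix B
    assume "B \<in> {U. openin Z U} \<union> {C. closedin Z C}" "t \<in> B"
    then have "B \<in> ?\<N>"
    proof (elim UnE)
      assume "B \<in> {U. openin Z U}"
      then show ?thesis
        using openin_subset[of Z B] by (intro CollectI exI[of _ B] exI[of _ "topspace Z"]) auto
    next
      assume "B \<in> {C. closedin Z C}"
      then show ?thesis
        using closedin_subset by (intro CollectI exI[of _ "topspace Z"] exI[of _ B]) auto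
    qed
    then show "\<exists>N\<in>?\<N>. t \<in> N \<and> N \<subseteq> B"
      by (rule bexI[rotated]) (simp add: \<open>t \<in> B\<close>)
  qed
  then show thesis
    using that by blast
qed

lemma topspace_patch [simp]: "topspace (patch_topology Z) = topspace Z"
  unfolding patch_topology_def topology_generated_by_topspace
  using openin_subset[of Z] openin_topspace[of Z] by blast

lemma topspace_strong_patch [simp]: "topspace (strong_patch_topology Z) = topspace Z"
  unfolding strong_patch_topology_def topology_generated_by_topspace
  using openin_subset[of Z] closedin_subset[of Z] openin_topspace[of Z] by blast

section \<open>The way-below relation\<close>

lemma way_below_mono:
  assumes "way_below X p q" "p' \<subseteq> p" "q \<subseteq> q'"
  shows "way_below X p' q'"
  unfolding way_below_def
proof (intro allI impI)
  fix \<C>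
  assume "(\<forall>U\<in>\<C>. openin X U) \<and> q' \<subseteq> \<Union>\<C>"
  then have "(\<forall>U\<in>\<C>. openin X U) \<and> q \<subseteq> \<Union>\<C>"
    using assms(3) by blast
  then obtain \<F> where "finite \<F>" "\<F> \<subseteq> \<C>" "p \<subseteq> \<Union>\<F>"
    using assms(1) unfolding way_below_def by meson
  then show "\<exists>\<F>. finite \<F> \<and> \<F> \<subseteq> \<C> \<and> p' \<subseteq> \<Union>\<F>"
    using assms(2) by blast
qed

text \<open>Apply the definition to the cover of \<open>q\<close> by itself.\<close>

lemma way_below_subset:
  assumes "way_below X p q" "openin X q"
  shows "p \<subseteq> q"
proof -
  have "\<exists>\<F>. finite \<F> \<and> \<F> \<subseteq> {q} \<and> p \<subseteq> \<Union>\<F>"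
    using assms(1)[unfolded way_below_def, rule_format, of "{q}"] assms(2) by simp
  then show ?thesis
    by blast
qed

lemma way_below_UN:
  assumes "finite I" "\<And>i. i \<in> I \<Longrightarrow> way_below X (p i) q"
  shows "way_below X (\<Union>i\<in>I. p i) q"
  unfolding way_below_def
proof (intro allI impI)
  fix \<C>
  assume "(\<forall>U\<in>\<C>. openin X U) \<and> q \<subseteq> \<Union>\<C>"
  then have "\<forall>i\<in>I. \<exists>\<F>. finite \<F> \<and> \<F> \<subseteq> \<C> \<and> p i \<subseteq> \<Union>\<F>"
    using assms(2) unfolding way_below_def by meson
  then obtain \<F> where \<F>: "\<forall>i\<in>I. finite (\<F> i) \<and> \<F> i \<subseteq> \<C> \<and> p i \<subseteq> \<Union>(\<F> i)"
    by metis
  show "\<exists>\<F>. finite \<F> \<and> \<F> \<subseteq> \<C> \<and> (\<Union>i\<in>I. p i) \<subseteq> \<Union>\<F>"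
  proof (intro exI conjI)
    show "finite (\<Union>i\<in>I. \<F> i)"
      using assms(1) \<F> by blast
    show "(\<Union>i\<in>I. \<F> i) \<subseteq> \<C>"
      using \<F> by (intro UN_least) simp
    show "(\<Union>i\<in>I. p i) \<subseteq> \<Union>(\<Union>i\<in>I. \<F> i)"
    proof (rule UN_least)
      fix i
      assume i: "i \<in> I"
      then have "p i \<subseteq> \<Union>(\<F> i)"
        using \<F> by simp
      also have "\<dots> \<subseteq> \<Union>(\<Union>i\<in>I. \<F> i)"
        using i by (intro Union_mono UN_upper)
      finally show "p i \<subseteq> \<Union>(\<Union>i\<in>I. \<F> i)" .
    qed
  qed
qed

text \<open>The definition of \<open>\<Subset>\<close> only yields \<open>p \<subseteq> \<Union>\<G>\<close>. The stronger conclusion comes from applying it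
  to the finer cover consisting of the open sets way below some member of \<open>\<C>\<close>, which still covers \<open>q\<close>
  by core compactness.\<close>

lemma way_below_subcover:
  assumes "core_compact X" "way_below X p q" "\<And>U. U \<in> \<C> \<Longrightarrow> openin X U" "q \<subseteq> \<Union>\<C>"
  obtains \<G> where "finite \<G>" "\<G> \<subseteq> \<C>" "way_below X p (\<Union>\<G>)"
proof -
  let ?\<D> = "{r. openin X r \<and> (\<exists>U\<in>\<C>. way_below X r U)}"
  have "q \<subseteq> \<Union>?\<D>"
  proof
    fix x
    assume "x \<in> q"
    then obtain U where U: "U \<in> \<C>" "x \<in> U"
      using assms(4) by blast
    then obtain r where "openin X r" "x \<in> r" "way_below X r U"
      using assms(1) assms(3)[OF U(1)] unfolding core_compact_def by blast
    then show "x \<in> \<Union>?\<D>"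
      using U by blast
  qed
  then obtain \<F> where \<F>: "finite \<F>" "\<F> \<subseteq> ?\<D>" "p \<subseteq> \<Union>\<F>"
    using assms(2)[unfolded way_below_def, rule_format, of ?\<D>] by blast
  then have "\<forall>r\<in>\<F>. \<exists>U\<in>\<C>. way_below X r U"
    by blast
  then obtain u where u: "\<forall>r\<in>\<F>. u r \<in> \<C> \<and> way_below X r (u r)"
    by metis
  have "way_below X (\<Union>r\<in>\<F>. r) (\<Union>(u ` \<F>))"
  proof (rule way_below_UN[OF \<F>(1)])
    fix r
    assume "r \<in> \<F>"
    then have "way_below X r (u r)"
      using u by blast
    then show "way_below X r (\<Union>(u ` \<F>))"
      by (rule way_below_mono) (use \<open>r \<in> \<F>\<close> in auto)
  qed
  then have "way_below X p (\<Union>(u ` \<F>))"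
    by (rule way_below_mono) (use \<F>(3) in auto)
  then show thesis
    using \<F>(1) u by (intro that[of "u ` \<F>"]) auto
qed

section \<open>Tight sets in a core compact space\<close>

text \<open>If \<open>x \<in> \<Union>G\<close>, core compactness puts an open set between \<open>x\<close> and \<open>\<Union>G\<close>, way below the latter, and
  that open set contains a finite intersection of subbasic neighbourhoods of \<open>x\<close>.\<close>

lemma subbasic_nbhds_tight_point:
  assumes "core_compact X" "subbasis_of X S" "x \<in> topspace X"
  shows "subbasic_nbhds S x \<in> tight_points S (cover_entails X)"
proof -
  have op: "\<And>p. p \<in> S \<Longrightarrow> openin X p" and cov: "\<Union>S = topspace X"
    using assms(2) by (auto simp: subbasis_of_def)
  have "(\<exists>F. finite F \<and> F \<subseteq> subbasic_nbhds S x \<and> cover_entails X F G)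
          \<longleftrightarrow> subbasic_nbhds S x \<inter> G \<noteq> {}"
    if G: "finite G" "G \<subseteq> S" for G
  proof
    assume "\<exists>F. finite F \<and> F \<subseteq> subbasic_nbhds S x \<and> cover_entails X F G"
    then obtain F where F: "F \<subseteq> subbasic_nbhds S x" "way_below X (topspace X \<inter> \<Inter>F) (\<Union>G)"
      by (auto simp: cover_entails_def)
    have "x \<in> topspace X \<inter> \<Inter>F"
      using F(1) assms(3) by (auto simp: subbasic_nbhds_def)
    moreover have "openin X (\<Union>G)"
      using op G by blast
    ultimately have "x \<in> \<Union>G"
      using way_below_subset[OF F(2)] by blast
    then show "subbasic_nbhds S x \<inter> G \<noteq> {}"
      using G(2) by (auto simp: subbasic_nbhds_def)
  next
    have opG: "openin X (\<Union>G)"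
      using op G by blast
    assume "subbasic_nbhds S x \<inter> G \<noteq> {}"
    then have "x \<in> \<Union>G"
      by (auto simp: subbasic_nbhds_def)
    then obtain q where q: "openin X q" "x \<in> q" "way_below X q (\<Union>G)"
      using assms(1) opG unfolding core_compact_def by blast
    obtain F where "finite F" "F \<subseteq> subbasic_nbhds S x" "topspace X \<inter> \<Inter>F \<subseteq> q"
      using subbasis_nbhd[OF assms(2) q(1,2)] .
    then show "\<exists>F. finite F \<and> F \<subseteq> subbasic_nbhds S x \<and> cover_entails X F G"
      using way_below_mono[OF q(3)] unfolding cover_entails_def by blast
  qed
  moreover have "subbasic_nbhds S x \<noteq> {}"
    using cov assms(3) by (auto simp: subbasic_nbhds_def)
  ultimately show ?thesis
    by (auto simp: tight_points_def tight_def subbasic_nbhds_def)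
qed

lemma tight_not_entails:
  assumes "tight S ent T" "finite F" "F \<subseteq> T" "finite G" "G \<subseteq> S - T"
  shows "\<not> ent F G"
  using assms unfolding tight_def by blast

lemma tight_entails_elem:
  assumes "tight S ent T" "p \<in> T"
  obtains F where "finite F" "F \<subseteq> T" "ent F {p}"
  using assms unfolding tight_def by (elim conjE allE[of _ "{p}"]) auto

text \<open>The main approximation of a tight set by points. A point \<open>x\<close> fails \<open>S\<^sub>x \<subseteq> T\<close> exactly when
  some member of \<open>S - T\<close> contains it, so if no point of \<open>U\<close> works, \<open>S - T\<close> covers \<open>U\<close> and a finite part
  of it is entailed by \<open>F\<close>.\<close>

lemma point_of_tight_set_in:
  assumes "core_compact X" "subbasis_of X S" "tight S (cover_entails X) T"
    and "finite F" "F \<subseteq> T" "way_below X (topspace X \<inter> \<Inter>F) U" "U \<subseteq> topspace X"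
  obtains x where "x \<in> U" "subbasic_nbhds S x \<subseteq> T"
proof (rule ccontr)
  assume "\<not> thesis"
  then have "U \<subseteq> \<Union>(S - T)"
    using that by (fastforce simp: subbasic_nbhds_def)
  moreover have "openin X p" if "p \<in> S - T" for p
    using that assms(2) by (auto simp: subbasis_of_def)
  ultimately obtain G where "finite G" "G \<subseteq> S - T" "way_below X (topspace X \<inter> \<Inter>F) (\<Union>G)"
    using way_below_subcover[OF assms(1,6), of "S - T"] by blast
  then show False
    using tight_not_entails[OF assms(3-5)] by (simp add: cover_entails_def)
qed

text \<open>Tightness gives this for each member of \<open>F\<close> separately; core coherence combines the results.\<close>

lemma tight_finite_subset_way_below:
  assumes "core_coherent X" "subbasis_of X S" "tight S (cover_entails X) T"
    and "finite F" "F \<noteq> {}" "F \<subseteq> T"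
  shows "\<exists>F'. finite F' \<and> F' \<subseteq> T \<and> way_below X (topspace X \<inter> \<Inter>F') (\<Inter>F)"
  using assms(4-6)
proof (induction rule: finite_ne_induct)
  case (singleton p)
  then show ?case
    using tight_entails_elem[OF assms(3), of p] by (auto simp: cover_entails_def)
next
  case (insert p F)
  have op: "openin X q" if "q \<in> T" for q
    using that assms(2,3) by (auto simp: subbasis_of_def tight_def)
  obtain F1 where F1: "finite F1" "F1 \<subseteq> T" "way_below X (topspace X \<inter> \<Inter>F1) (\<Inter>F)"
    using insert by blast
  obtain F2 where F2: "finite F2" "F2 \<subseteq> T" "way_below X (topspace X \<inter> \<Inter>F2) p"
    using tight_entails_elem[OF assms(3), of p] insert.prems by (auto simp: cover_entails_def)
  let ?H = "F1 \<union> F2"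
  have "openin X (topspace X \<inter> \<Inter>?H)"
    using F1 F2 op by (intro openin_Int_Inter) auto
  moreover have "openin X (\<Inter>F)" "openin X p"
    using insert op by (auto intro!: openin_Inter)
  moreover have "way_below X (topspace X \<inter> \<Inter>?H) (\<Inter>F)" "way_below X (topspace X \<inter> \<Inter>?H) p"
    by (rule way_below_mono[OF F1(3)] way_below_mono[OF F2(3)]; blast)+
  ultimately have "way_below X (topspace X \<inter> \<Inter>?H) (p \<inter> \<Inter>F)"
    using assms(1) unfolding core_coherent_def by blast
  then show ?case
    using F1 F2 by (intro exI[of _ ?H]) auto
qed

lemma coherent_point_of_tight_set:
  assumes "core_compact X" "core_coherent X" "subbasis_of X S" "tight S (cover_entails X) T" "T \<noteq> {}"
    and "finite F" "F \<subseteq> T"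
  obtains x where "x \<in> topspace X" "F \<subseteq> subbasic_nbhds S x" "subbasic_nbhds S x \<subseteq> T"
proof -
  obtain t where t: "t \<in> T"
    using assms(5) by blast
  have TS: "T \<subseteq> S" "\<And>p. p \<in> S \<Longrightarrow> p \<subseteq> topspace X"
    using assms(3,4) openin_subset by (auto simp: subbasis_of_def tight_def)
  \<comment> \<open>Adding \<open>t\<close> allows \<open>F = {}\<close> and keeps the intersection inside the space.\<close>
  obtain F' where "finite F'" "F' \<subseteq> T" "way_below X (topspace X \<inter> \<Inter>F') (\<Inter>(insert t F))"
    using tight_finite_subset_way_below[OF assms(2-4), of "insert t F"] assms(6,7) t by auto
  moreover have "\<Inter>(insert t F) \<subseteq> topspace X"
    using t TS by auto
  ultimately obtain x where "x \<in> \<Inter>(insert t F)" "subbasic_nbhds S x \<subseteq> T"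
    using point_of_tight_set_in[OF assms(1,3,4)] by metis
  moreover have "t \<subseteq> topspace X"
    using t TS by blast
  ultimately have "x \<in> topspace X" "F \<subseteq> subbasic_nbhds S x"
    using \<open>x \<in> \<Inter>(insert t F)\<close> TS(1) assms(7) by (auto simp: subbasic_nbhds_def)
  then show thesis
    using that \<open>subbasic_nbhds S x \<subseteq> T\<close> by blast
qed

section \<open>The topology of the tight spectrum\<close>

lemma openin_tight_spectrum_Collect:
  assumes "finite F" "F \<subseteq> S"
  shows "openin (tight_spectrum S ent) {T \<in> tight_points S ent. F \<subseteq> T}"
proof -
  have "openin (tight_spectrum S ent) (topspace (tight_spectrum S ent) \<inter>
          (\<Inter>p\<in>F. {T \<in> tight_points S ent. p \<in> T}))"
  proof (intro openin_Int_Inter)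
    fix B
    assume "B \<in> (\<lambda>p. {T \<in> tight_points S ent. p \<in> T}) ` F"
    then show "openin (tight_spectrum S ent) B"
      using assms(2) unfolding tight_spectrum_def by (intro topology_generated_by_Basis) blast
  qed (use assms in auto)
  moreover have "topspace (tight_spectrum S ent) \<inter> (\<Inter>p\<in>F. {T \<in> tight_points S ent. p \<in> T})
      = {T \<in> tight_points S ent. F \<subseteq> T}"
    by (auto simp: topspace_tight_spectrum)
  ultimately show ?thesis
    by simp
qed

lemma tight_spectrum_nbhd:
  assumes "openin (tight_spectrum S ent) W" "T \<in> W"
  obtains F where "finite F" "F \<subseteq> T" "{T' \<in> tight_points S ent. F \<subseteq> T'} \<subseteq> W"
proof -
  let ?\<N> = "{{T \<in> tight_points S ent. F \<subseteq> T} | F. finite F}"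
  have "\<exists>N\<in>?\<N>. T \<in> N \<and> N \<subseteq> W"
  proof (rule generated_topology_nbhd[OF assms[unfolded tight_spectrum_def]])
    fix M N
    assume "M \<in> ?\<N>" "N \<in> ?\<N>"
    then obtain F G where FG: "finite F" "M = {T \<in> tight_points S ent. F \<subseteq> T}"
      "finite G" "N = {T \<in> tight_points S ent. G \<subseteq> T}"
      by blast
    then have "M \<inter> N = {T \<in> tight_points S ent. F \<union> G \<subseteq> T}"
      by blast
    then show "M \<inter> N \<in> ?\<N>"
      using FG by (intro CollectI exI[of _ "F \<union> G"]) auto
  next
    fix B
    assume "B \<in> (\<lambda>p. {T \<in> tight_points S ent. p \<in> T}) ` S" "T \<in> B"
    then obtain p where p: "B = {T \<in> tight_points S ent. {p} \<subseteq> T}"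
      by auto
    then have "B \<in> ?\<N>"
      by (intro CollectI exI[of _ "{p}"]) auto
    then show "\<exists>N\<in>?\<N>. T \<in> N \<and> N \<subseteq> B"
      by (rule bexI[rotated]) (simp add: \<open>T \<in> B\<close>)
  qed
  then show thesis
    using that by blast
qed

lemma specialises_tight_spectrum:
  assumes "T \<in> tight_points S ent" "T' \<in> tight_points S ent"
  shows "specialises (tight_spectrum S ent) T T' \<longleftrightarrow> T' \<subseteq> T"
proof
  assume sp: "specialises (tight_spectrum S ent) T T'"
  show "T' \<subseteq> T"
  proof
    fix p
    assume p: "p \<in> T'"
    then have "p \<in> S"
      using assms(2) by (auto simp: tight_points_def tight_def)
    then show "p \<in> T"
      using openin_tight_spectrum_Collect[of "{p}" S ent] sp assms(2) p
      unfolding specialises_def by fastforce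
  qed
next
  assume sub: "T' \<subseteq> T"
  show "specialises (tight_spectrum S ent) T T'"
    unfolding specialises_def
  proof (intro allI impI, elim conjE)
    fix W
    assume "openin (tight_spectrum S ent) W" "T' \<in> W"
    then obtain F where "F \<subseteq> T'" "{T' \<in> tight_points S ent. F \<subseteq> T'} \<subseteq> W"
      by (rule tight_spectrum_nbhd)
    then show "T \<in> W"
      using sub assms(1) by blast
  qed
qed

section \<open>Embedding a core compact space in its tight spectrum\<close>

locale core_compact_subbasis =
  fixes X :: "'a topology" and S :: "'a set set"
  assumes core_compact: "core_compact X" and subbasis: "subbasis_of X S"
begin

abbreviation "TS \<equiv> tight_spectrum S (cover_entails X)"
abbreviation "D \<equiv> subbasic_nbhds S ` topspace X"

lemma openin_subbasis: "p \<in> S \<Longrightarrow> openin X p"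
  using subbasis by (auto simp: subbasis_of_def)

lemma points_subset_spectrum: "D \<subseteq> topspace TS"
  using subbasic_nbhds_tight_point[OF core_compact subbasis]
  by (auto simp: topspace_tight_spectrum)

text \<open>An open set separating two points contains a finite intersection of subbasic sets around one of
  them, so some subbasic set already separates them.\<close>

lemma inj_subbasic_nbhds:
  assumes "t0_space X"
  shows "inj_on (subbasic_nbhds S) (topspace X)"
proof (rule inj_onI, rule ccontr)
  fix x y
  assume xy: "x \<in> topspace X" "y \<in> topspace X" "subbasic_nbhds S x = subbasic_nbhds S y" "x \<noteq> y"
  then obtain U where U: "openin X U" "(x \<in> U) \<noteq> (y \<in> U)"
    using assms unfolding t0_space_def by blast
  have mem: "v \<in> U" if "u \<in> U" "v \<in> topspace X" "subbasic_nbhds S u = subbasic_nbhds S v" for u v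
  proof -
    obtain F where F: "F \<subseteq> subbasic_nbhds S u" "topspace X \<inter> \<Inter>F \<subseteq> U"
      using subbasis_nbhd[OF subbasis U(1) \<open>u \<in> U\<close>] .
    then have "v \<in> \<Inter>F"
      using that(3) by (auto simp: subbasic_nbhds_def)
    then show "v \<in> U"
      using F(2) that(2) by blast
  qed
  show False
    using U(2) mem[of x y] mem[of y x] xy by metis
qed

text \<open>The preimage of the subbasic open set of the spectrum given by \<open>p\<close> is \<open>p\<close> itself, so the two
  subbases correspond to each other.\<close>

lemma homeomorphic_map_subbasic_nbhds:
  assumes "t0_space X"
  shows "homeomorphic_map X (subtopology TS D) (subbasic_nbhds S)"
proof -
  have top: "topspace (subtopology TS D) = D"
    using points_subset_spectrum by (rule topspace_subtopology_subset)
  have pre: "subbasic_nbhds S -` {T \<in> tight_points S (cover_entails X). p \<in> T} \<inter> topspace X = p"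
    if "p \<in> S" for p
    using that openin_subset[OF openin_subbasis[OF that]]
      subbasic_nbhds_tight_point[OF core_compact subbasis]
    by (auto simp: subbasic_nbhds_def)
  have "continuous_map X TS (subbasic_nbhds S)"
    unfolding tight_spectrum_def
  proof (rule continuous_on_generated_topo)
    fix U
    assume "U \<in> (\<lambda>p. {T \<in> tight_points S (cover_entails X). p \<in> T}) ` S"
    then show "openin X (subbasic_nbhds S -` U \<inter> topspace X)"
      using pre openin_subbasis by auto
  next
    show "subbasic_nbhds S ` topspace X
        \<subseteq> \<Union>((\<lambda>p. {T \<in> tight_points S (cover_entails X). p \<in> T}) ` S)"
      using points_subset_spectrum
      unfolding tight_spectrum_def topology_generated_by_topspace .
  qed
  then have cont: "continuous_map X (subtopology TS D) (subbasic_nbhds S)"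
    by (simp add: continuous_map_in_subtopology)
  have "open_map X (subtopology TS D) (subbasic_nbhds S)"
    unfolding open_map_def
  proof (intro allI impI)
    fix U
    assume U: "openin X U"
    have "\<exists>W. openin (subtopology TS D) W \<and> T \<in> W \<and> W \<subseteq> subbasic_nbhds S ` U"
      if T: "T \<in> subbasic_nbhds S ` U" for T
    proof -
      obtain x where x: "x \<in> U" "T = subbasic_nbhds S x"
        using T by blast
      obtain F where F: "finite F" "F \<subseteq> subbasic_nbhds S x" "topspace X \<inter> \<Inter>F \<subseteq> U"
        using subbasis_nbhd[OF subbasis U x(1)] .
      let ?W = "{T \<in> tight_points S (cover_entails X). F \<subseteq> T} \<inter> D"
      have "F \<subseteq> S"
        using F(2) by (auto simp: subbasic_nbhds_def)
      then have "openin (subtopology TS D) ?W"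
        using openin_tight_spectrum_Collect[OF F(1)] unfolding openin_subtopology by blast
      moreover have "T \<in> D"
        using x U openin_subset by blast
      then have "T \<in> ?W"
        using F(2) x(2) points_subset_spectrum by (auto simp: topspace_tight_spectrum)
      moreover have "?W \<subseteq> subbasic_nbhds S ` U"
      proof
        fix T'
        assume "T' \<in> ?W"
        then obtain y where y: "y \<in> topspace X" "T' = subbasic_nbhds S y" "F \<subseteq> subbasic_nbhds S y"
          by blast
        then have "y \<in> U"
          using F(3) by (auto simp: subbasic_nbhds_def)
        then show "T' \<in> subbasic_nbhds S ` U"
          using y by blast
      qed
      ultimately show ?thesis
        by blast
    qed
    then show "openin (subtopology TS D) (subbasic_nbhds S ` U)"
      using openin_subopen[of "subtopology TS D" "subbasic_nbhds S ` U"] by blast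
  qed
  then show ?thesis
    by (rule bijective_open_imp_homeomorphic_map[OF cont _ top[symmetric]
          inj_subbasic_nbhds[OF assms]])
qed

lemma saturation_points: "saturation TS D = topspace TS"
proof
  show "topspace TS \<subseteq> saturation TS D"
  proof
    fix T
    assume "T \<in> topspace TS"
    then have T: "T \<in> tight_points S (cover_entails X)" "tight S (cover_entails X) T" "T \<noteq> {}" "T \<subseteq> S"
      by (auto simp: topspace_tight_spectrum tight_points_def tight_def)
    then obtain p where p: "p \<in> T"
      by blast
    obtain F where F: "finite F" "F \<subseteq> T" "cover_entails X F {p}"
      using tight_entails_elem[OF T(2) p] .
    have pX: "p \<subseteq> topspace X"
      using p T(4) openin_subbasis openin_subset by blast
    obtain x where x: "x \<in> p" "subbasic_nbhds S x \<subseteq> T"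
      using point_of_tight_set_in[OF core_compact subbasis T(2) F(1,2) _ pX] F(3)
      by (auto simp: cover_entails_def)
    then have "subbasic_nbhds S x \<in> D"
      using pX by blast
    moreover have "specialises TS T (subbasic_nbhds S x)"
      using specialises_tight_spectrum[OF T(1)] x pX
        subbasic_nbhds_tight_point[OF core_compact subbasis] by blast
    ultimately show "T \<in> saturation TS D"
      using T(1) by (auto simp: saturation_def topspace_tight_spectrum)
  qed
qed (auto simp: saturation_def)

text \<open>Compactness of \<open>K\<close> is applied to the cover by the sets of tight points containing \<open>H\<^sub>k\<close>, where
  \<open>H\<^sub>k \<turnstile> {p\<^sub>k}\<close>, rather than to the larger sets given by the \<open>p\<^sub>k\<close>. The latter would only show
  \<open>\<Inter>F \<subseteq> \<Union>G\<close> with \<open>G\<close> the set of the chosen \<open>p\<^sub>k\<close>, which does not contradict tightness.\<close>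

lemma patch_closure_points: "patch_topology TS closure_of D = topspace TS"
proof
  show "topspace TS \<subseteq> patch_topology TS closure_of D"
  proof
    fix T
    assume TZ: "T \<in> topspace TS"
    then have T: "T \<in> tight_points S (cover_entails X)" "tight S (cover_entails X) T" "T \<subseteq> S"
      by (auto simp: topspace_tight_spectrum tight_points_def tight_def)
    have "\<exists>y\<in>D. y \<in> W" if W: "T \<in> W" "openin (patch_topology TS) W" for W
    proof (rule ccontr)
      assume disj: "\<not> (\<exists>y\<in>D. y \<in> W)"
      obtain U K where UK: "openin TS U" "compactin TS K" "saturated TS K" "T \<in> U" "T \<notin> K" "U - K \<subseteq> W"
        using openin_patch_nbhd[OF W(2,1)] .
      obtain F where F: "finite F" "F \<subseteq> T" "{T' \<in> tight_points S (cover_entails X). F \<subseteq> T'} \<subseteq> U"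
        using tight_spectrum_nbhd[OF UK(1,4)] .
      have KZ: "K \<subseteq> tight_points S (cover_entails X)"
        using compactin_subset_topspace[OF UK(2)] by (simp add: topspace_tight_spectrum)
      \<comment> \<open>As \<open>K\<close> is saturated and misses \<open>T\<close>, no member of \<open>K\<close> is a subset of \<open>T\<close>.\<close>
      have "\<exists>H p. finite H \<and> H \<subseteq> k \<and> p \<in> S - T \<and> cover_entails X H {p}" if "k \<in> K" for k
      proof -
        have k: "k \<in> tight_points S (cover_entails X)"
          using KZ that by blast
        then have kt: "tight S (cover_entails X) k" "k \<subseteq> S"
          by (auto simp: tight_points_def tight_def)
        have "\<not> specialises TS T k"
          using UK(3,5) that TZ unfolding saturated_def saturation_def by blast
        then obtain p where "p \<in> k" "p \<notin> T"
          using specialises_tight_spectrum[OF T(1) k] by blast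
        then show ?thesis
          using tight_entails_elem[OF kt(1) \<open>p \<in> k\<close>] kt(2) by (metis DiffI subsetD)
      qed
      then obtain H p where Hp: "\<And>k. k \<in> K \<Longrightarrow>
          finite (H k) \<and> H k \<subseteq> k \<and> p k \<in> S - T \<and> cover_entails X (H k) {p k}"
        by metis
      let ?N = "\<lambda>k. {T' \<in> tight_points S (cover_entails X). H k \<subseteq> T'}"
      have "openin TS (?N k)" if "k \<in> K" for k
      proof (rule openin_tight_spectrum_Collect)
        show "H k \<subseteq> S"
          using Hp[OF that] KZ that by (fastforce simp: tight_points_def tight_def)
      qed (use Hp[OF that] in blast)
      moreover have "K \<subseteq> \<Union>(?N ` K)"
        using Hp KZ by blast
      ultimately obtain \<F> where \<F>: "finite \<F>" "\<F> \<subseteq> ?N ` K" "K \<subseteq> \<Union>\<F>"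
        using compactinD[OF UK(2), of "?N ` K"] by (metis (no_types, lifting) imageE)
      obtain L where "L \<subseteq> K" "finite L" "\<F> = ?N ` L"
        using finite_subset_image[OF \<F>(1,2)] by (elim exE conjE)
      with \<F>(3) have L: "finite L" "L \<subseteq> K" "K \<subseteq> \<Union>(?N ` L)"
        by simp_all
      \<comment> \<open>By assumption no \<open>S\<^sub>x\<close> is in \<open>W\<close>, so those in \<open>U\<close> must lie in \<open>K\<close>.\<close>
      have F_sub: "topspace X \<inter> \<Inter>F \<subseteq> (\<Union>k\<in>L. topspace X \<inter> \<Inter>(H k))"
      proof
        fix x
        assume x: "x \<in> topspace X \<inter> \<Inter>F"
        have "F \<subseteq> subbasic_nbhds S x"
          using x F(2) T(3) by (auto simp: subbasic_nbhds_def)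
        then have "subbasic_nbhds S x \<in> U"
          using F(3) subbasic_nbhds_tight_point[OF core_compact subbasis] x by blast
        then have "subbasic_nbhds S x \<in> K"
          using disj UK(6) x by blast
        then obtain k where "k \<in> L" "H k \<subseteq> subbasic_nbhds S x"
          using L(3) by blast
        then show "x \<in> (\<Union>k\<in>L. topspace X \<inter> \<Inter>(H k))"
          using x by (auto simp: subbasic_nbhds_def)
      qed
      have "way_below X (\<Union>k\<in>L. topspace X \<inter> \<Inter>(H k)) (\<Union>(p ` L))"
      proof (rule way_below_UN[OF L(1)])
        fix k
        assume "k \<in> L"
        then have "way_below X (topspace X \<inter> \<Inter>(H k)) (p k)"
          using Hp[of k] L(2) by (auto simp: cover_entails_def)
        then show "way_below X (topspace X \<inter> \<Inter>(H k)) (\<Union>(p ` L))"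
          by (rule way_below_mono) (use \<open>k \<in> L\<close> in auto)
      qed
      then have "cover_entails X F (p ` L)"
        unfolding cover_entails_def by (rule way_below_mono[OF _ F_sub subset_refl])
      moreover have "p ` L \<subseteq> S - T"
        using Hp L(2) by blast
      ultimately show False
        using tight_not_entails[OF T(2) F(1,2), of "p ` L"] L(1) by simp
    qed
    then show "T \<in> patch_topology TS closure_of D"
      using TZ by (simp add: in_closure_of)
  qed
qed (use closure_of_subset_topspace[of "patch_topology TS" D] in simp)

lemma very_dense_points: "very_dense TS D"
  by (simp add: very_dense_def points_subset_spectrum saturation_points patch_closure_points)

text \<open>A closed set containing \<open>T\<close> contains every tight point that is a subset of \<open>T\<close>. So a basic
  neighbourhood of \<open>T\<close> in the strong patch topology contains \<open>S\<^sub>x\<close> as soon as \<open>F \<subseteq> S\<^sub>x \<subseteq> T\<close> for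
  a suitable finite \<open>F \<subseteq> T\<close>.\<close>

lemma strongly_dense_points:
  assumes "core_coherent X"
  shows "strongly_dense TS D"
proof -
  have "T \<in> strong_patch_topology TS closure_of D" if TZ: "T \<in> topspace TS" for T
  proof -
    have T: "T \<in> tight_points S (cover_entails X)" "tight S (cover_entails X) T" "T \<noteq> {}"
      using TZ by (auto simp: topspace_tight_spectrum tight_points_def)
    have "\<exists>y\<in>D. y \<in> W" if W: "T \<in> W" "openin (strong_patch_topology TS) W" for W
    proof -
      obtain U C where UC: "openin TS U" "closedin TS C" "T \<in> U" "T \<in> C" "U \<inter> C \<subseteq> W"
        using openin_strong_patch_nbhd[OF W(2,1)] .
      obtain F where F: "finite F" "F \<subseteq> T" "{T' \<in> tight_points S (cover_entails X). F \<subseteq> T'} \<subseteq> U"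
        using tight_spectrum_nbhd[OF UC(1,3)] .
      obtain x where x: "x \<in> topspace X" "F \<subseteq> subbasic_nbhds S x" "subbasic_nbhds S x \<subseteq> T"
        using coherent_point_of_tight_set[OF core_compact assms subbasis T(2,3) F(1,2)] .
      have Sx: "subbasic_nbhds S x \<in> tight_points S (cover_entails X)"
        using subbasic_nbhds_tight_point[OF core_compact subbasis x(1)] .
      have "specialises TS T (subbasic_nbhds S x)"
        using specialises_tight_spectrum[OF T(1) Sx] x(3) by blast
      moreover have "openin TS (topspace TS - C)"
        using UC(2) by blast
      ultimately have "subbasic_nbhds S x \<in> C"
        using UC(4) Sx unfolding specialises_def topspace_tight_spectrum by blast
      moreover have "subbasic_nbhds S x \<in> U"
        using F(3) Sx x(2) by blast
      ultimately show ?thesis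
        using UC(5) x(1) by blast
    qed
    then show ?thesis
      using TZ by (simp add: in_closure_of)
  qed
  then show ?thesis
    using closure_of_subset_topspace[of "strong_patch_topology TS" D] points_subset_spectrum
    unfolding strongly_dense_def by auto
qed

text \<open>The set is the complement of \<open>\<Union>(S - T)\<close>, hence closed. If it meets the open sets containing
  \<open>\<Inter>F\<close> and \<open>\<Inter>G\<close> around points \<open>a\<close> and \<open>b\<close> of it, then \<open>F \<union> G \<subseteq> S\<^sub>a \<union> S\<^sub>b \<subseteq> T\<close>, and
  approximating \<open>T\<close> above \<open>F \<union> G\<close> yields a point of it in both.\<close>

lemma irreducible_closed_of_tight_set:
  assumes "core_coherent X" "tight S (cover_entails X) T" "T \<noteq> {}"
  shows "irreducible_closed X {x \<in> topspace X. subbasic_nbhds S x \<subseteq> T}" (is "irreducible_closed X ?C")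
proof -
  note point = coherent_point_of_tight_set[OF core_compact assms(1) subbasis assms(2,3)]
  have "?C = topspace X - \<Union>(S - T)"
    by (auto simp: subbasic_nbhds_def)
  moreover have "openin X (\<Union>(S - T))"
    using openin_subbasis by blast
  ultimately have "closedin X ?C"
    using closedin_diff[OF closedin_topspace] by metis
  moreover have "?C \<noteq> {}"
    by (rule point[of "{}"]) auto
  moreover have "?C = A \<or> ?C = B" if AB: "closedin X A" "closedin X B" "?C = A \<union> B" for A B
  proof (rule ccontr)
    assume "\<not> (?C = A \<or> ?C = B)"
    then obtain a b where ab: "a \<in> ?C" "a \<notin> A" "b \<in> ?C" "b \<notin> B"
      using AB(3) by blast
    obtain F where F: "finite F" "F \<subseteq> subbasic_nbhds S a" "topspace X \<inter> \<Inter>F \<subseteq> topspace X - A"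
      using subbasis_nbhd[OF subbasis, of "topspace X - A" a] AB(1) ab by blast
    obtain G where G: "finite G" "G \<subseteq> subbasic_nbhds S b" "topspace X \<inter> \<Inter>G \<subseteq> topspace X - B"
      using subbasis_nbhd[OF subbasis, of "topspace X - B" b] AB(2) ab by blast
    obtain x where x: "x \<in> topspace X" "F \<union> G \<subseteq> subbasic_nbhds S x" "subbasic_nbhds S x \<subseteq> T"
    proof (rule point)
      show "finite (F \<union> G)" "F \<union> G \<subseteq> T"
        using F G ab by auto
    qed
    then have "x \<notin> A" "x \<notin> B"
      using F(3) G(3) by (auto simp: subbasic_nbhds_def)
    moreover have "x \<in> ?C"
      using x by blast
    ultimately show False
      using AB(3) by blast
  qed
  ultimately show ?thesis
    unfolding irreducible_closed_def by blast
qed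

text \<open>The generic point \<open>x\<close> of \<open>{y. S\<^sub>y \<subseteq> T}\<close> belongs to this set, so \<open>S\<^sub>x \<subseteq> T\<close>. Conversely each
  \<open>p \<in> T\<close> contains some \<open>y\<close> of the set, and as \<open>y\<close> is in the closure of \<open>x\<close>, also \<open>x \<in> p\<close>.\<close>

lemma points_eq_spectrum:
  assumes "core_coherent X" "sober X"
  shows "D = topspace TS"
proof
  show "topspace TS \<subseteq> D"
  proof
    fix T
    assume "T \<in> topspace TS"
    then have T: "tight S (cover_entails X) T" "T \<noteq> {}" "T \<subseteq> S"
      by (auto simp: topspace_tight_spectrum tight_points_def tight_def)
    let ?C = "{x \<in> topspace X. subbasic_nbhds S x \<subseteq> T}"
    obtain x where x: "x \<in> topspace X" "?C = X closure_of {x}"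
      using irreducible_closed_of_tight_set[OF assms(1) T(1,2)] assms(2) unfolding sober_def by blast
    have "x \<in> ?C"
      using x closure_of_subset[of "{x}" X] by blast
    moreover have "T \<subseteq> subbasic_nbhds S x"
    proof
      fix p
      assume p: "p \<in> T"
      obtain y where "y \<in> topspace X" "{p} \<subseteq> subbasic_nbhds S y" "subbasic_nbhds S y \<subseteq> T"
        using coherent_point_of_tight_set[OF core_compact assms(1) subbasis T(1,2), of "{p}"] p by blast
      then have "y \<in> X closure_of {x}" "y \<in> p" "p \<in> S"
        using x(2) by (auto simp: subbasic_nbhds_def)
      then have "x \<in> p"
        using openin_subbasis by (auto simp: in_closure_of)
      then show "p \<in> subbasic_nbhds S x"
        using \<open>p \<in> S\<close> by (simp add: subbasic_nbhds_def)
    qed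
    ultimately show "T \<in> D"
      by blast
  qed
qed (rule points_subset_spectrum)

end

theorem theorem3p13:
  fixes X :: "'a topology" and S :: "'a set set"
  assumes "t0_space X" and "core_compact X" and "subbasis_of X S"
  shows "homeomorphic_map X
           (subtopology (tight_spectrum S (cover_entails X)) (subbasic_nbhds S ` topspace X))
           (subbasic_nbhds S)
       \<and> very_dense (tight_spectrum S (cover_entails X)) (subbasic_nbhds S ` topspace X)
       \<and> (core_coherent X \<longrightarrow>
            strongly_dense (tight_spectrum S (cover_entails X)) (subbasic_nbhds S ` topspace X))
       \<and> (core_coherent X \<and> sober X \<longrightarrow>
            subbasic_nbhds S ` topspace X = topspace (tight_spectrum S (cover_entails X)))"
proof -
  interpret core_compact_subbasis X S
    using assms(2,3) by unfold_locales
  show ?thesis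
    using homeomorphic_map_subbasic_nbhds[OF assms(1)] very_dense_points strongly_dense_points
      points_eq_spectrum by blast
qed

end
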